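(* Let $G$ be a transitive permutation group on a finite set $X$ containing an abelian semiregular subgroup $H$. Let $\Gamma$ be a $G$-invariant digraph on $X$ with symbol $\mathbf{S}$ relative to $H$, and let $\lambda \neq \mathrm{val}(\Gamma)$ be an eigenvalue of $\Gamma$. Let $N_\lambda$ be the kernel of the action of $G$ on the $\lambda$-eigenspace $W_\lambda$. Then: (i) $N_\lambda$ contains $\langle K_{\mathbf{S},\lambda}\rangle^{\bot}$. (ii) If $\langle K_{\mathbf{S},\lambda}\rangle < H^*$ is a proper subgroup, then the orbits of $N_\lambda$ form a nontrivial $G$-invariant partition of $X$.
   Context: Group actions are on the right. A permutation group $H$ on $X$ is semiregular if it is nontrivial and all its point stabilizers are trivial. A $G$-invariant partition of $X$ is a block system for $G$; it is nontrivial if it is neither the partition into singletons nor the partition with the single class $X$. A $G$-invariant digraph on $X$ is a digraph with vertex set $X$ and arc set a $G$-invariant subset of $X\times X$. Since $G$ is transitive, each vertex has the same number of in- and out-neighbours, the valency $\mathrm{val}(\Gamma)$. Write $x\to_\Gamma y$ if there is an arc from $x$ to $y$. Let $X_1,\dots,X_m$ be the $H$-orbits, with chosen reference points $b_i\in X_i$. The symbol of $\Gamma$ is the array $\mathbf{S}=[S_{ij}\mid 1\le i,j\le m]$ with $S_{ij}=\{h\in H\mid b_i\to_\Gamma b_j^{h}\}$. Let $H^*$ be the group of complex irreducible characters of the abelian group $H$. For $\chi\in H^*$ and $S\subseteq H$ put $\chi(S)=\sum_{g\in S}\chi(g^{-1})$ (so $\chi(\emptyset)=0$), and let $\chi(\mathbf{S})$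 be the $m\times m$ matrix with $(i,j)$ entry $\chi(S_{ij})$. Set $K_{\mathbf{S},\lambda}=\{\chi\in H^*\mid \det(\chi(\mathbf{S})-\lambda I_m)=0\}$. For $L^*\subseteq H^*$, $L^{*\bot}=\bigcap_{\chi\in L^*}\ker\chi\le H$. Matrices act on row vectors from the right. $V_X$ is the space of complex row vectors indexed by $X$, and the $\lambda$-eigenspace is $W_\lambda=\{\mathbf{w}\in V_X\mid \mathbf{w}A=\lambda\mathbf{w}\}$, where $A$ is the adjacency matrix of $\Gamma$ ($A_{x,y}=1$ if $x\to_\Gamma y$, and $0$ otherwise). $G$ acts on $V_X$ by $(\mathbf{w}^g)_x=\mathbf{w}_{x^{g^{-1}}}$, and $W_\lambda$ is invariant under this action. *)

theory Defs
  imports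
    Complex_Main
    "HOL-Algebra.Group_Action"
    "HOL-Algebra.Generated_Groups"
    "HOL-Library.Disjoint_Sets"
    "Jordan_Normal_Form.VS_Connect"
begin

section \<open>Permutation groups\<close>

text \<open>
  A permutation group on \<open>X\<close> is a subgroup of the library's \<open>BijGroup X\<close>, and \<open>x\<^sup>g\<close> is rendered as
  \<open>g x\<close>. The product of \<open>BijGroup\<close> is \<open>g \<circ> f\<close>, so right actions turn into left actions of the
  opposite group. This reversal changes neither subgroups, inverses, orbits, stabilizers and
  kernels, nor anything about an abelian group.
\<close>

abbreviation perm_grp :: "'a set \<Rightarrow> ('a \<Rightarrow> 'a) set \<Rightarrow> ('a \<Rightarrow> 'a) monoid" where
  "perm_grp X G \<equiv> (BijGroup X)\<lparr>carrier := G\<rparr>"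

definition semiregular :: "'a set \<Rightarrow> ('a \<Rightarrow> 'a) set \<Rightarrow> bool" where
  "semiregular X H \<longleftrightarrow> H \<noteq> {\<one>\<^bsub>BijGroup X\<^esub>} \<and>
     (\<forall>x\<in>X. stabilizer (perm_grp X H) (\<lambda>g. g) x = {\<one>\<^bsub>BijGroup X\<^esub>})"

definition perm_orbits :: "'a set \<Rightarrow> ('a \<Rightarrow> 'a) set \<Rightarrow> 'a set set" where
  "perm_orbits X G = orbits (perm_grp X G) X (\<lambda>g. g)"

definition block_system :: "'a set \<Rightarrow> ('a \<Rightarrow> 'a) set \<Rightarrow> 'a set set \<Rightarrow> bool" where
  "block_system X G P \<longleftrightarrow> partition_on X P \<and> (\<forall>g\<in>G. (\<lambda>B. g ` B) ` P = P)"

definition nontrivial_block_system :: "'a set \<Rightarrow> ('a \<Rightarrow> 'a) set \<Rightarrow> 'a set set \<Rightarrow> bool" where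
  "nontrivial_block_system X G P \<longleftrightarrow>
     block_system X G P \<and> P \<noteq> (\<lambda>x. {x}) ` X \<and> P \<noteq> {X}"

section \<open>Invariant digraphs and their eigenspaces\<close>

definition invariant_digraph :: "'a set \<Rightarrow> ('a \<Rightarrow> 'a) set \<Rightarrow> ('a \<times> 'a) set \<Rightarrow> bool" where
  "invariant_digraph X G E \<longleftrightarrow>
     E \<subseteq> X \<times> X \<and> (\<forall>g\<in>G. (\<lambda>(x, y). (g x, g y)) ` E = E)"

text \<open>Well defined for a digraph invariant under a transitive group on a nonempty finite set.\<close>

definition valency :: "'a set \<Rightarrow> ('a \<times> 'a) set \<Rightarrow> nat" where
  "valency X E = (THE d. \<forall>x\<in>X. card {y\<in>X. (x, y) \<in> E} = d \<and> card {y\<in>X. (y, x) \<in> E} = d)"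

definition adjacency :: "('a \<times> 'a) set \<Rightarrow> 'a \<Rightarrow> 'a \<Rightarrow> complex" where
  "adjacency E x y = (if (x, y) \<in> E then 1 else 0)"

text \<open>
  Row vectors indexed by \<open>X\<close> are functions that are \<open>undefined\<close> outside \<open>X\<close>, so that equality of
  functions is equality of vectors.
\<close>

definition row_vectors :: "'a set \<Rightarrow> ('a \<Rightarrow> complex) set" where
  "row_vectors X = X \<rightarrow>\<^sub>E UNIV"

definition row_times_adjacency ::
    "'a set \<Rightarrow> ('a \<times> 'a) set \<Rightarrow> ('a \<Rightarrow> complex) \<Rightarrow> 'a \<Rightarrow> complex" where
  "row_times_adjacency X E w = (\<lambda>y\<in>X. \<Sum>x\<in>X. w x * adjacency E x y)"

definition eigenspace :: "'a set \<Rightarrow> ('a \<times> 'a) set \<Rightarrow> complex \<Rightarrow> ('a \<Rightarrow> complex) set" where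
  "eigenspace X E lam =
     {w \<in> row_vectors X. row_times_adjacency X E w = (\<lambda>x\<in>X. lam * w x)}"

definition is_eigenvalue :: "'a set \<Rightarrow> ('a \<times> 'a) set \<Rightarrow> complex \<Rightarrow> bool" where
  "is_eigenvalue X E lam \<longleftrightarrow> (\<exists>w\<in>eigenspace X E lam. w \<noteq> (\<lambda>x\<in>X. 0))"

definition vector_action ::
    "'a set \<Rightarrow> ('a \<Rightarrow> 'a) \<Rightarrow> ('a \<Rightarrow> complex) \<Rightarrow> 'a \<Rightarrow> complex" where
  "vector_action X g w = (\<lambda>x\<in>X. w ((inv\<^bsub>BijGroup X\<^esub> g) x))"

definition eigenspace_kernel ::
    "'a set \<Rightarrow> ('a \<Rightarrow> 'a) set \<Rightarrow> ('a \<times> 'a) set \<Rightarrow> complex \<Rightarrow> ('a \<Rightarrow> 'a) set" where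
  "eigenspace_kernel X G E lam = {g\<in>G. \<forall>w\<in>eigenspace X E lam. vector_action X g w = w}"

section \<open>Irreducible complex characters\<close>

definition representation ::
    "('g, 'b) monoid_scheme \<Rightarrow> nat \<Rightarrow> ('g \<Rightarrow> complex mat) \<Rightarrow> bool" where
  "representation H n \<rho> \<longleftrightarrow>
     (\<forall>h\<in>carrier H. \<rho> h \<in> carrier_mat n n) \<and> \<rho> \<one>\<^bsub>H\<^esub> = 1\<^sub>m n \<and>
     (\<forall>g\<in>carrier H. \<forall>h\<in>carrier H. \<rho> (g \<otimes>\<^bsub>H\<^esub> h) = \<rho> g * \<rho> h)"

definition irreducible_representation ::
    "('g, 'b) monoid_scheme \<Rightarrow> nat \<Rightarrow> ('g \<Rightarrow> complex mat) \<Rightarrow> bool" where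
  "irreducible_representation H n \<rho> \<longleftrightarrow> representation H n \<rho> \<and> n > 0 \<and>
     (\<forall>W. VectorSpace.subspace class_ring W (module_vec TYPE(complex) n) \<and>
          (\<forall>h\<in>carrier H. \<forall>w\<in>W. \<rho> h *\<^sub>v w \<in> W) \<longrightarrow>
          W = {0\<^sub>v n} \<or> W = carrier_vec n)"

definition irreducible_characters :: "('g, 'b) monoid_scheme \<Rightarrow> ('g \<Rightarrow> complex) set" where
  "irreducible_characters H =
     {\<lambda>h\<in>carrier H. \<Sum>i<n. \<rho> h $$ (i, i) | n \<rho>. irreducible_representation H n \<rho>}"

text \<open>A group under pointwise multiplication only for abelian \<open>H\<close>.\<close>

definition character_group :: "('g, 'b) monoid_scheme \<Rightarrow> ('g \<Rightarrow> complex) monoid" where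
  "character_group H =
     \<lparr>carrier = irreducible_characters H,
      mult = \<lambda>\<chi> \<psi>. \<lambda>h\<in>carrier H. \<chi> h * \<psi> h,
      one = \<lambda>h\<in>carrier H. 1\<rparr>"

text \<open>The kernel of a character; the value at the identity is its degree, 1 for abelian \<open>H\<close>.\<close>

definition character_kernel :: "('g, 'b) monoid_scheme \<Rightarrow> ('g \<Rightarrow> complex) \<Rightarrow> 'g set" where
  "character_kernel H \<chi> = {h\<in>carrier H. \<chi> h = \<chi> \<one>\<^bsub>H\<^esub>}"

text \<open>Intersecting with the carrier only matters for empty \<open>L\<close>.\<close>

definition character_perp ::
    "('g, 'b) monoid_scheme \<Rightarrow> ('g \<Rightarrow> complex) set \<Rightarrow> 'g set" where
  "character_perp H L = carrier H \<inter> (\<Inter>\<chi>\<in>L. character_kernel H \<chi>)"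

definition character_sum ::
    "('g, 'b) monoid_scheme \<Rightarrow> ('g \<Rightarrow> complex) \<Rightarrow> 'g set \<Rightarrow> complex" where
  "character_sum H \<chi> S = (\<Sum>g\<in>S. \<chi> (inv\<^bsub>H\<^esub> g))"

section \<open>Symbols\<close>

text \<open>Orbits are numbered from \<open>0\<close> to \<open>m - 1\<close>; \<open>b i\<close> is the reference point of the \<open>i\<close>-th one.\<close>

definition reference_points ::
    "'a set \<Rightarrow> ('a \<Rightarrow> 'a) set \<Rightarrow> nat \<Rightarrow> (nat \<Rightarrow> 'a set) \<Rightarrow> (nat \<Rightarrow> 'a) \<Rightarrow> bool" where
  "reference_points X H m Xs b \<longleftrightarrow>
     bij_betw Xs {..<m} (perm_orbits X H) \<and> (\<forall>i<m. b i \<in> Xs i)"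

definition digraph_symbol ::
    "('a \<Rightarrow> 'a) set \<Rightarrow> ('a \<times> 'a) set \<Rightarrow> (nat \<Rightarrow> 'a) \<Rightarrow> nat \<Rightarrow> nat \<Rightarrow> ('a \<Rightarrow> 'a) set" where
  "digraph_symbol H E b i j = {h\<in>H. (b i, h (b j)) \<in> E}"

definition character_matrix ::
    "('g, 'b) monoid_scheme \<Rightarrow> nat \<Rightarrow> (nat \<Rightarrow> nat \<Rightarrow> 'g set) \<Rightarrow> ('g \<Rightarrow> complex) \<Rightarrow> complex mat" where
  "character_matrix H m S \<chi> = mat m m (\<lambda>(i, j). character_sum H \<chi> (S i j))"

definition K_set ::
    "('g, 'b) monoid_scheme \<Rightarrow> nat \<Rightarrow> (nat \<Rightarrow> nat \<Rightarrow> 'g set) \<Rightarrow> complex \<Rightarrow> ('g \<Rightarrow> complex) set" where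
  "K_set H m S lam =
     {\<chi>\<in>carrier (character_group H). det (character_matrix H m S \<chi> - lam \<cdot>\<^sub>m 1\<^sub>m m) = 0}"

end

theory Submission
  imports
    Defs
    "HOL-Algebra.Multiplicative_Group"
    "Jordan_Normal_Form.Spectral_Radius"
begin

text \<open>
  The abelian group \<open>H\<close> acts diagonalizably on the eigenspace, and every joint eigenfunction \<open>v\<close>
  comes with a character \<open>\<chi>\<close> of \<open>H\<close>. The values of \<open>v\<close> at the reference points form a nonzero row vector
  killed by \<open>\<chi>(S) - lam\<close>, so \<open>\<chi> \<in> K\<close>, and the annihilator of \<open>K\<close> fixes \<open>v\<close>. If \<open>\<langle>K\<rangle>\<close> is proper, its
  annihilator contains some \<open>h \<noteq> 1\<close>, so the orbits of the kernel, which is normal in \<open>G\<close>, are not all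
  singletons; and the kernel is not transitive, since an eigenfunction constant on \<open>X\<close> has
  eigenvalue \<open>val(\<Gamma>)\<close>.
\<close>

section \<open>Characters of finite abelian groups\<close>

text \<open>Extensionality matches the restricted traces in \<open>irreducible_characters\<close>.
  The value 1 at the identity and multiplicativity keep \<open>\<chi>\<close> nonzero on the group,
  so these are its homomorphisms into the nonzero complex numbers.\<close>

definition linear_character :: "('g, 'b) monoid_scheme \<Rightarrow> ('g \<Rightarrow> complex) \<Rightarrow> bool" where
  "linear_character H \<chi> \<longleftrightarrow> \<chi> \<in> extensional (carrier H) \<and> \<chi> \<one>\<^bsub>H\<^esub> = 1 \<and>
     (\<forall>g\<in>carrier H. \<forall>h\<in>carrier H. \<chi> (g \<otimes>\<^bsub>H\<^esub> h) = \<chi> g * \<chi> h)"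

lemma vec_subspace_iff:
  "VectorSpace.subspace class_ring W (module_vec TYPE('a::field) n) \<longleftrightarrow>
     W \<subseteq> carrier_vec n \<and> 0\<^sub>v n \<in> W \<and> (\<forall>v\<in>W. \<forall>w\<in>W. v + w \<in> W) \<and> (\<forall>c. \<forall>v\<in>W. c \<cdot>\<^sub>v v \<in> W)"
  by (auto simp: VectorSpace.subspace_def submodule_def vec_vs vec_module module_vec_simps
      class_ring_simps)

lemma vec_subspace_dim_one:
  assumes "VectorSpace.subspace class_ring W (module_vec TYPE('a::field) 1)"
  shows "W = {0\<^sub>v 1} \<or> W = carrier_vec 1"
proof (cases "W \<subseteq> {0\<^sub>v 1}")
  case True
  then show ?thesis using assms by (auto simp: vec_subspace_iff)
next
  case False
  then obtain w where w: "w \<in> W" "w \<noteq> 0\<^sub>v 1" by auto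
  have wc: "w \<in> carrier_vec 1" using assms w by (auto simp: vec_subspace_iff)
  have w0: "w $ 0 \<noteq> 0"
  proof
    assume "w $ 0 = 0"
    then have "w = 0\<^sub>v 1" using wc by (intro eq_vecI) auto
    with w show False by simp
  qed
  have "v \<in> W" if v: "v \<in> carrier_vec 1" for v
  proof -
    have "v = (v $ 0 / w $ 0) \<cdot>\<^sub>v w" using v wc w0 by (intro eq_vecI) auto
    moreover have "(v $ 0 / w $ 0) \<cdot>\<^sub>v w \<in> W" using assms w by (auto simp: vec_subspace_iff)
    ultimately show ?thesis by simp
  qed
  then show ?thesis using assms by (auto simp: vec_subspace_iff)
qed

text \<open>A one-dimensional space has no proper nonzero subspace, so \<open>\<chi>\<close> written
  as 1 by 1 matrices is irreducible, and it is its own trace.\<close>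

lemma linear_character_irreducible:
  assumes \<chi>: "linear_character H \<chi>"
  shows "\<chi> \<in> irreducible_characters H"
proof -
  define \<rho> where "\<rho> = (\<lambda>h. mat 1 1 (\<lambda>_. \<chi> h))"
  have "representation H 1 \<rho>"
    using \<chi> unfolding representation_def linear_character_def \<rho>_def
    by (auto intro!: eq_matI simp: scalar_prod_def)
  then have irr: "irreducible_representation H 1 \<rho>"
    unfolding irreducible_representation_def using vec_subspace_dim_one by auto
  have "\<chi> = (\<lambda>h\<in>carrier H. \<Sum>i<1. \<rho> h $$ (i, i))"
    using \<chi> unfolding linear_character_def \<rho>_def
    by (intro extensionalityI[of _ "carrier H"]) auto
  then show ?thesis
    unfolding irreducible_characters_def using irr by blast
qed

section \<open>Schur's lemma for commutative groups\<close>

context comm_group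
begin

text \<open>An eigenspace of \<open>\<rho> h\<close> is preserved by every \<open>\<rho> g\<close>,
  since these matrices commute with \<open>\<rho> h\<close>. Being nonzero, it is the whole space by
  irreducibility.\<close>

lemma irreducible_representation_scalar:
  assumes irr: "irreducible_representation G n \<rho>" and h: "h \<in> carrier G"
  obtains c where "\<rho> h = c \<cdot>\<^sub>m 1\<^sub>m n"
proof -
  have n: "n > 0" and rep: "representation G n \<rho>"
    using irr by (auto simp: irreducible_representation_def)
  have \<rho>c: "\<rho> g \<in> carrier_mat n n" if "g \<in> carrier G" for g
    using rep that by (auto simp: representation_def)
  have comm: "\<rho> g * \<rho> h = \<rho> h * \<rho> g" if "g \<in> carrier G" for g
    using rep that h m_comm[of g h] by (metis representation_def)
  obtain c where "eigenvalue (\<rho> h) c"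
    using spectrum_non_empty[OF \<rho>c[OF h] n] by (auto simp: spectrum_def)
  then obtain v where v: "v \<in> carrier_vec n" "v \<noteq> 0\<^sub>v n" "\<rho> h *\<^sub>v v = c \<cdot>\<^sub>v v"
    using \<rho>c[OF h] by (auto simp: eigenvalue_def eigenvector_def)
  define W where "W = {v \<in> carrier_vec n. \<rho> h *\<^sub>v v = c \<cdot>\<^sub>v v}"
  have "VectorSpace.subspace class_ring W (module_vec TYPE(complex) n)"
    unfolding vec_subspace_iff W_def using \<rho>c[OF h]
    by (auto simp: mult_add_distrib_mat_vec smult_add_distrib_vec mult_mat_vec smult_smult_assoc
        mult.commute)
  moreover have "\<rho> g *\<^sub>v w \<in> W" if g: "g \<in> carrier G" and w: "w \<in> W" for g w
  proof -
    have wc: "w \<in> carrier_vec n" "\<rho> h *\<^sub>v w = c \<cdot>\<^sub>v w" using w by (auto simp: W_def)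
    have "\<rho> h *\<^sub>v (\<rho> g *\<^sub>v w) = (\<rho> h * \<rho> g) *\<^sub>v w"
      using \<rho>c[OF g] \<rho>c[OF h] wc by simp
    also have "\<dots> = \<rho> g *\<^sub>v (\<rho> h *\<^sub>v w)"
      using \<rho>c[OF g] \<rho>c[OF h] wc by (simp flip: comm[OF g])
    also have "\<dots> = c \<cdot>\<^sub>v (\<rho> g *\<^sub>v w)"
      using \<rho>c[OF g] wc by (simp add: mult_mat_vec)
    finally show ?thesis using \<rho>c[OF g] wc by (simp add: W_def)
  qed
  moreover have "W \<noteq> {0\<^sub>v n}" using v by (auto simp: W_def)
  ultimately have W: "W = carrier_vec n"
    using irr by (auto simp: irreducible_representation_def)
  have "\<rho> h = c \<cdot>\<^sub>m 1\<^sub>m n"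
  proof (rule eq_matI)
    fix i j assume ij: "i < dim_row (c \<cdot>\<^sub>m 1\<^sub>m n)" "j < dim_col (c \<cdot>\<^sub>m 1\<^sub>m n)"
    then have "unit_vec n j \<in> W" using W by simp
    then have "(\<rho> h *\<^sub>v unit_vec n j) $ i = (c \<cdot>\<^sub>v unit_vec n j) $ i"
      by (simp add: W_def)
    then show "\<rho> h $$ (i, j) = (c \<cdot>\<^sub>m 1\<^sub>m n) $$ (i, j)"
      using ij \<rho>c[OF h] by (simp add: scalar_prod_right_unit)
  qed (use \<rho>c[OF h] in auto)
  then show ?thesis using that by blast
qed

text \<open>Scalar matrices preserve every subspace, so in dimension above 1 the first coordinate
  axis would contradict irreducibility.\<close>

lemma irreducible_representation_dim:
  assumes irr: "irreducible_representation G n \<rho>"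
  shows "n = 1"
proof (rule ccontr)
  assume "n \<noteq> 1"
  then have n: "n > 1" using irr by (auto simp: irreducible_representation_def)
  define W :: "complex vec set" where "W = {v \<in> carrier_vec n. \<forall>i<n. i \<noteq> 0 \<longrightarrow> v $ i = 0}"
  have "VectorSpace.subspace class_ring W (module_vec TYPE(complex) n)"
    unfolding vec_subspace_iff W_def by auto
  moreover have "\<rho> h *\<^sub>v w \<in> W" if h: "h \<in> carrier G" and w: "w \<in> W" for h w
  proof -
    obtain c where "\<rho> h = c \<cdot>\<^sub>m 1\<^sub>m n"
      using irreducible_representation_scalar[OF irr h] .
    then have "\<rho> h *\<^sub>v w = c \<cdot>\<^sub>v w"
      using w by (auto simp: W_def intro!: eq_vecI)
    then show ?thesis using w by (auto simp: W_def)
  qed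
  ultimately have "W = {0\<^sub>v n} \<or> W = carrier_vec n"
    using irr by (auto simp: irreducible_representation_def)
  moreover have "unit_vec n 0 \<in> W" "unit_vec n 0 \<noteq> (0\<^sub>v n :: complex vec)"
    using n by (auto simp: W_def dest: arg_cong[of _ _ "\<lambda>v. v $ 0"])
  moreover have "unit_vec n 1 \<notin> W" using n by (auto simp: W_def)
  ultimately show False by auto
qed

lemma irreducible_characters_eq:
  "irreducible_characters G = {\<chi>. linear_character G \<chi>}"
proof
  show "irreducible_characters G \<subseteq> {\<chi>. linear_character G \<chi>}"
  proof
    fix \<chi> assume "\<chi> \<in> irreducible_characters G"
    then obtain n \<rho> where irr: "irreducible_representation G n \<rho>"
      and \<chi>: "\<chi> = (\<lambda>h\<in>carrier G. \<Sum>i<n. \<rho> h $$ (i, i))"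
      by (auto simp: irreducible_characters_def)
    have n: "n = 1" using irreducible_representation_dim[OF irr] .
    have rep: "representation G 1 \<rho>"
      using irr n by (auto simp: irreducible_representation_def)
    have "(\<rho> g * \<rho> h) $$ (0, 0) = \<rho> g $$ (0, 0) * \<rho> h $$ (0, 0)"
      if "g \<in> carrier G" "h \<in> carrier G" for g h
    proof -
      have "\<rho> g \<in> carrier_mat 1 1" "\<rho> h \<in> carrier_mat 1 1"
        using rep that by (auto simp: representation_def)
      then show ?thesis by (simp add: scalar_prod_def)
    qed
    then show "\<chi> \<in> {\<chi>. linear_character G \<chi>}"
      using rep unfolding \<chi> n linear_character_def representation_def by auto
  qed
qed (use linear_character_irreducible in auto)

section \<open>Orthogonality relations and annihilators\<close>

lemma linear_character_inv:
  assumes "linear_character G \<chi>" "h \<in> carrier G"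
  shows "\<chi> (inv h) * \<chi> h = 1"
  using assms by (metis linear_character_def inv_closed l_inv)

text \<open>By Lagrange, all values are roots of unity whose order divides the group order, which
  leaves finitely many functions.\<close>

lemma finite_linear_characters:
  assumes "finite (carrier G)"
  shows "finite {\<chi>. linear_character G \<chi>}"
proof (rule finite_subset)
  have n: "Coset.order G > 0" using assms by (simp add: order_gt_0_iff_finite)
  show "finite (carrier G \<rightarrow>\<^sub>E {z::complex. z ^ Coset.order G = 1})"
    using assms n by (intro finite_PiE finite_nth_roots) auto
  show "{\<chi>. linear_character G \<chi>} \<subseteq> carrier G \<rightarrow>\<^sub>E {z. z ^ Coset.order G = 1}"
  proof
    fix \<chi> assume "\<chi> \<in> {\<chi>. linear_character G \<chi>}"
    then have \<chi>: "linear_character G \<chi>" by simp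
    have "\<chi> (h [^] k) = \<chi> h ^ k" if "h \<in> carrier G" for h and k :: nat
      using \<chi> that by (induction k) (auto simp: linear_character_def)
    then have "\<chi> h ^ Coset.order G = 1" if "h \<in> carrier G" for h
      using \<chi> that pow_order_eq_1[OF that] by (metis linear_character_def)
    then show "\<chi> \<in> carrier G \<rightarrow>\<^sub>E {z. z ^ Coset.order G = 1}"
      using \<chi> by (auto simp: linear_character_def PiE_def)
  qed
qed

text \<open>Translating the summation variable by some \<open>g\<close> with
  \<open>\<chi> g \<noteq> \<psi> g\<close> multiplies the sum by
  \<open>\<psi> (inv g) * \<chi> g\<close>, which is not 1, so the sum vanishes.\<close>

lemma linear_character_orthogonality:
  assumes \<chi>: "linear_character G \<chi>" and \<psi>: "linear_character G \<psi>" and ne: "\<chi> \<noteq> \<psi>"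
  shows "(\<Sum>h\<in>carrier G. \<psi> (inv h) * \<chi> h) = 0"
proof -
  obtain g where g: "g \<in> carrier G" "\<chi> g \<noteq> \<psi> g"
    using ne \<chi> \<psi> unfolding linear_character_def by (meson extensionalityI)
  let ?S = "\<Sum>h\<in>carrier G. \<psi> (inv h) * \<chi> h"
  have "bij_betw (\<lambda>h. g \<otimes> h) (carrier G) (carrier G)"
    using g by (intro bij_betw_byWitness[of _ "\<lambda>h. inv g \<otimes> h"]) (auto simp: m_assoc[symmetric])
  then have "?S = (\<Sum>h\<in>carrier G. \<psi> (inv (g \<otimes> h)) * \<chi> (g \<otimes> h))"
    by (rule sum.reindex_bij_betw[symmetric])
  also have "\<dots> = (\<Sum>h\<in>carrier G. (\<psi> (inv g) * \<chi> g) * (\<psi> (inv h) * \<chi> h))"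
    using g \<chi> \<psi> by (intro sum.cong) (auto simp: linear_character_def inv_mult mult_ac)
  finally have "?S = (\<psi> (inv g) * \<chi> g) * ?S" unfolding sum_distrib_left .
  moreover have "\<psi> (inv g) * \<chi> g \<noteq> 1"
    using linear_character_inv[OF \<psi> g(1)] g(2)
    by (metis mult_left_cancel mult_zero_left zero_neq_one)
  ultimately show ?thesis by simp
qed

text \<open>
  If \<open>L\<close> had trivial annihilator, then \<open>\<Sum>\<chi>\<in>L. \<chi> h\<close> would vanish for \<open>h \<noteq> \<one>\<close>. The inner product of
  this function with a character outside \<open>L\<close> is then \<open>card L\<close>, but it is \<open>0\<close> by orthogonality.
\<close>

lemma character_perp_nontrivial:
  assumes fin: "finite (carrier G)" and L: "L \<subset> {\<chi>. linear_character G \<chi>}" "L \<noteq> {}"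
    and mult: "\<And>\<chi> \<psi>. \<chi> \<in> L \<Longrightarrow> \<psi> \<in> L \<Longrightarrow> (\<lambda>h\<in>carrier G. \<chi> h * \<psi> h) \<in> L"
  shows "character_perp G L \<noteq> {\<one>}"
proof
  assume perp: "character_perp G L = {\<one>}"
  have lin: "linear_character G \<chi>" if "\<chi> \<in> L" for \<chi> using L that by auto
  have finL: "finite L"
    using finite_subset[OF _ finite_linear_characters[OF fin]] L by blast
  obtain \<psi> where \<psi>: "linear_character G \<psi>" "\<psi> \<notin> L" using L by auto
  have zero: "(\<Sum>\<chi>\<in>L. \<chi> h) = 0" if h: "h \<in> carrier G" "h \<noteq> \<one>" for h
  proof -
    have "h \<notin> character_perp G L" using perp h by simp
    then obtain \<theta> where \<theta>: "\<theta> \<in> L" "\<theta> h \<noteq> \<theta> \<one>"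
      using h by (auto simp: character_perp_def character_kernel_def)
    then have \<theta>h: "\<theta> h \<noteq> 1" using lin[OF \<theta>(1)] by (simp add: linear_character_def)
    \<comment> \<open>Multiplication by \<open>\<theta>\<close> is injective on the finite set
      \<open>L\<close> and maps it into itself, hence permutes it. The sum thus equals
      \<open>\<theta> h\<close> times itself, with \<open>\<theta> h \<noteq> 1\<close>.\<close>
    define T where "T = (\<lambda>\<chi>. \<lambda>h\<in>carrier G. \<theta> h * \<chi> h)"
    have "inj_on T L"
    proof (rule inj_onI)
      fix \<chi> \<chi>' assume a: "\<chi> \<in> L" "\<chi>' \<in> L" "T \<chi> = T \<chi>'"
      have "\<chi> k = \<chi>' k" if "k \<in> carrier G" for k
      proof -
        have "\<theta> k * \<chi> k = \<theta> k * \<chi>' k"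
          using a(3) that unfolding T_def by (auto dest: fun_cong[of _ _ k])
        then show ?thesis using linear_character_inv[OF lin[OF \<theta>(1)] that] by auto
      qed
      then show "\<chi> = \<chi>'" using lin a by (auto simp: linear_character_def intro: extensionalityI)
    qed
    moreover have "T ` L \<subseteq> L" using mult \<theta> by (auto simp: T_def)
    ultimately have "bij_betw T L L" using finL by (simp add: bij_betw_def endo_inj_surj)
    then have "(\<Sum>\<chi>\<in>L. \<chi> h) = (\<Sum>\<chi>\<in>L. T \<chi> h)"
      by (rule sum.reindex_bij_betw[symmetric])
    also have "\<dots> = \<theta> h * (\<Sum>\<chi>\<in>L. \<chi> h)"
      using h by (simp add: T_def sum_distrib_left)
    finally show ?thesis using \<theta>h by simp
  qed
  have "(\<Sum>\<chi>\<in>L. \<chi> \<one>) = (\<Sum>\<chi>\<in>L. 1)"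
    using lin by (intro sum.cong) (auto simp: linear_character_def)
  then have "(\<Sum>h\<in>carrier G. \<psi> (inv h) * (\<Sum>\<chi>\<in>L. \<chi> h)) =
        (\<Sum>h\<in>carrier G. if h = \<one> then of_nat (card L) else 0)"
    using zero \<psi> by (intro sum.cong) (auto simp: linear_character_def)
  also have "\<dots> = of_nat (card L)" using fin by simp
  finally have "of_nat (card L) = (\<Sum>h\<in>carrier G. \<Sum>\<chi>\<in>L. \<psi> (inv h) * \<chi> h)"
    by (simp add: sum_distrib_left)
  also have "\<dots> = (\<Sum>\<chi>\<in>L. \<Sum>h\<in>carrier G. \<psi> (inv h) * \<chi> h)" by (rule sum.swap)
  also have "\<dots> = (\<Sum>\<chi>\<in>L. 0)"
    using linear_character_orthogonality[OF lin \<psi>(1)] \<psi>(2) by (intro sum.cong refl) blast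
  finally show False using finL L by simp
qed

end

section \<open>Joint eigenfunctions of commuting maps of finite order\<close>

text \<open>The \<open>j\<close>-th discrete Fourier component of \<open>v\<close> along the orbits
  of \<open>f\<close>. If \<open>f\<close> has period \<open>n\<close>, it is the projection of
  \<open>v\<close> onto the eigenfunctions of composition with \<open>f\<close> whose eigenvalue is
  the \<open>-j\<close>-th power of the root of unity.\<close>

definition cyclic_part ::
    "nat \<Rightarrow> ('a \<Rightarrow> 'a) \<Rightarrow> ('a \<Rightarrow> complex) \<Rightarrow> nat \<Rightarrow> 'a \<Rightarrow> complex" where
  "cyclic_part n f v j x = (\<Sum>k<n. cis (2 * pi / n) ^ (j * k) / n * v ((f ^^ k) x))"

lemma sum_cis_power:
  assumes "k < n"
  shows "(\<Sum>j<n. cis (2 * pi / n) ^ (j * k)) = (if k = 0 then of_nat n else 0)"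
proof (cases "k = 0")
  case False
  let ?w = "cis (2 * pi / n)"
  have n: "n > 0" using assms by simp
  have pow: "?w ^ i = cis (2 * pi * real i / real n)" for i
    by (simp add: DeMoivre mult_ac)
  \<comment> \<open>Distinct exponents below \<open>n\<close> give distinct roots of unity;
    comparing \<open>k\<close> with 0 shows that the ratio of the geometric sum is not 1.\<close>
  have "inj_on (\<lambda>k. cis (2 * pi * real k / real n)) {..<n}"
    using bij_betw_roots_unity[OF n] by (rule bij_betw_imp_inj_on)
  then have "?w ^ k \<noteq> 1"
    using inj_onD[of _ _ k 0] assms False n by (fastforce simp: pow)
  moreover have "(?w ^ k) ^ n = 1"
  proof -
    have "(?w ^ k) ^ n = (?w ^ n) ^ k" by (simp add: mult.commute flip: power_mult)
    also have "?w ^ n = 1" using n by (simp add: pow)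
    finally show ?thesis by simp
  qed
  ultimately have "(\<Sum>j<n. (?w ^ k) ^ j) = 0" by (simp add: geometric_sum)
  then show ?thesis using False by (simp add: mult.commute flip: power_mult)
qed simp

text \<open>Fourier inversion: summing over \<open>j\<close> first kills every term except
  \<open>k = 0\<close>.\<close>

lemma sum_cyclic_part:
  assumes "n > 0"
  shows "(\<Sum>j<n. cyclic_part n f v j x) = v x"
proof -
  let ?w = "cis (2 * pi / n)"
  have "(\<Sum>j<n. cyclic_part n f v j x)
      = (\<Sum>k<n. (\<Sum>j<n. ?w ^ (j * k)) / n * v ((f ^^ k) x))"
    unfolding cyclic_part_def by (subst sum.swap) (simp add: sum_distrib_right sum_divide_distrib)
  also have "\<dots> = (\<Sum>k<n. if k = 0 then v x else 0)"
    using assms by (intro sum.cong) (auto simp: sum_cis_power)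
  also have "\<dots> = v x" using assms by simp
  finally show ?thesis .
qed

lemma cyclic_part_shift:
  assumes n: "n > 0" and per: "(f ^^ n) x = x"
  shows "cyclic_part n f v j (f x) = cis (2 * pi / n) powi (- int j) * cyclic_part n f v j x"
proof -
  let ?w = "cis (2 * pi / n)"
  define g where "g = (\<lambda>k. ?w ^ (j * k) / n * v ((f ^^ k) x))"
  have "?w ^ n = 1" using n by (simp add: DeMoivre)
  then have "?w ^ (j * n) = 1" by (metis mult.commute power_mult power_one)
  \<comment> \<open>Periodicity makes the term just past the end equal the first one, so shifting
    the index leaves the sum unchanged. Replacing \<open>x\<close> by \<open>f x\<close> causes this
    shift, up to the factor \<open>?w ^ j\<close>.\<close>
  then have "g n = g 0" using per by (simp add: g_def)
  then have "(\<Sum>k<n. g (Suc k)) = (\<Sum>k<n. g k)"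
    using sum.lessThan_Suc_shift[of g n] sum.lessThan_Suc[of g n] by simp
  moreover have "?w ^ j * cyclic_part n f v j (f x) = (\<Sum>k<n. g (Suc k))"
    unfolding cyclic_part_def g_def sum_distrib_left
    by (intro sum.cong) (simp_all add: power_add funpow_swap1)
  ultimately have "?w ^ j * cyclic_part n f v j (f x) = cyclic_part n f v j x"
    by (simp add: g_def cyclic_part_def)
  then show ?thesis by (simp add: power_int_minus field_simps)
qed

text \<open>
  The cyclic parts of \<open>v\<close> under one more map split \<open>v\<close> into eigenfunctions of that map, without
  losing the eigenfunction property for the maps already treated.
\<close>

lemma invariant_if_joint_eigenfunctions_invariant:
  fixes W :: "('a \<Rightarrow> complex) set"
  assumes "finite F" and v: "v \<in> W"
    and maps: "\<And>f x. f \<in> F \<Longrightarrow> x \<in> X \<Longrightarrow> f x \<in> X"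
    and comm: "\<And>f g x. f \<in> F \<Longrightarrow> g \<in> F \<Longrightarrow> x \<in> X \<Longrightarrow> f (g x) = g (f x)"
    and period: "\<And>f. f \<in> F \<Longrightarrow> \<exists>n>0. \<forall>x\<in>X. (f ^^ n) x = x"
    and comp: "\<And>f v. f \<in> F \<Longrightarrow> v \<in> W \<Longrightarrow> (\<lambda>x. v (f x)) \<in> W"
    and sums: "\<And>n c u. (\<And>k. k < n \<Longrightarrow> u k \<in> W) \<Longrightarrow> (\<lambda>x. \<Sum>k<n::nat. c k * u k x) \<in> W"
    and joint: "\<And>v x. v \<in> W \<Longrightarrow> (\<forall>f\<in>F. \<exists>c. \<forall>x\<in>X. v (f x) = c * v x) \<Longrightarrow> x \<in> X \<Longrightarrow> v (h x) = v x"
    and x: "x \<in> X"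
  shows "v (h x) = v x"
  using assms(1) v maps comm period comp joint x
proof (induction F arbitrary: v x rule: finite_induct)
  case empty
  then show ?case by simp
next
  case (insert f F)
  show ?case
  proof (rule insert.IH)
    \<comment> \<open>What the induction hypothesis leaves open is its premise \<open>joint\<close>
      for the smaller set: here \<open>v\<close> is already a joint eigenfunction for
      \<open>F\<close>, and only \<open>f\<close> is still to be diagonalized.\<close>
    fix v x
    assume v: "v \<in> W" "\<forall>g\<in>F. \<exists>c. \<forall>x\<in>X. v (g x) = c * v x" and x: "x \<in> X"
    obtain n where n: "n > 0" "\<And>x. x \<in> X \<Longrightarrow> (f ^^ n) x = x"
      using insert.prems(4)[of f] by auto
    have pow_X: "(f ^^ k) x \<in> X" if "x \<in> X" for k x
      using that by (induction k) (auto intro: insert.prems(2))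
    have pow_W: "(\<lambda>x. v ((f ^^ k) x)) \<in> W" for k
    proof (induction k)
      case (Suc k)
      then show ?case using insert.prems(5)[of f, OF _ Suc] by (simp add: funpow_swap1)
    qed (use v in simp)
    have pow_comm: "(f ^^ k) (g x) = g ((f ^^ k) x)" if "g \<in> F" "x \<in> X" for k g x
    proof (induction k)
      case (Suc k)
      then show ?case using insert.prems(3)[of f g, OF _ _ pow_X[OF that(2), of k]] that by simp
    qed simp
    have part: "cyclic_part n f v j (h x) = cyclic_part n f v j x" if x: "x \<in> X" for j x
    proof (rule insert.prems(6)[OF _ _ x])
      show "cyclic_part n f v j \<in> W"
        unfolding cyclic_part_def[abs_def] by (intro sums pow_W)
      have "\<exists>c. \<forall>x\<in>X. cyclic_part n f v j (g x) = c * cyclic_part n f v j x" if g: "g \<in> F" for g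
      proof -
        obtain c where "\<forall>x\<in>X. v (g x) = c * v x" using v g by blast
        \<comment> \<open>Powers of \<open>f\<close> commute with \<open>g\<close>, so each part
          keeps the eigenvalue \<open>c\<close> that \<open>v\<close> has under
          \<open>g\<close>.\<close>
        then have "\<forall>x\<in>X. cyclic_part n f v j (g x) = c * cyclic_part n f v j x"
          using g by (simp add: cyclic_part_def pow_comm pow_X sum_distrib_left mult_ac)
        then show ?thesis ..
      qed
      then show "\<forall>g\<in>insert f F. \<exists>c. \<forall>x\<in>X. cyclic_part n f v j (g x) = c * cyclic_part n f v j x"
        using cyclic_part_shift[OF n(1) n(2), of _ v j] by blast
    qed
    have "v (h x) = (\<Sum>j<n. cyclic_part n f v j (h x))"
      by (simp add: sum_cyclic_part n)
    also have "\<dots> = v x" using x by (simp add: part sum_cyclic_part n)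
    finally show "v (h x) = v x" .
  qed (use insert.prems in auto)
qed

section \<open>Eigenfunctions of invariant digraphs\<close>

text \<open>Leaves values outside \<open>X\<close> free, so that sums and compositions with
  permutations need no restriction to \<open>X\<close>.\<close>

definition eigenfunction :: "'a set \<Rightarrow> ('a \<times> 'a) set \<Rightarrow> complex \<Rightarrow> ('a \<Rightarrow> complex) \<Rightarrow> bool" where
  "eigenfunction X E lam w \<longleftrightarrow> (\<forall>y\<in>X. (\<Sum>x\<in>X. w x * adjacency E x y) = lam * w y)"

lemma eigenspace_eq: "eigenspace X E lam = {w \<in> extensional X. eigenfunction X E lam w}"
  unfolding eigenspace_def row_vectors_def row_times_adjacency_def eigenfunction_def PiE_UNIV_domain
  by (auto simp: PiE_def fun_eq_iff restrict_def)

lemma eigenfunction_cong: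
  assumes "\<And>x. x \<in> X \<Longrightarrow> v x = w x"
  shows "eigenfunction X E lam v \<longleftrightarrow> eigenfunction X E lam w"
  unfolding eigenfunction_def using assms by simp

lemma eigenfunction_sum:
  assumes "\<And>k. k \<in> A \<Longrightarrow> eigenfunction X E lam (u k)"
  shows "eigenfunction X E lam (\<lambda>x. \<Sum>k\<in>A. c k * u k x)"
  unfolding eigenfunction_def
proof
  fix y assume y: "y \<in> X"
  have "(\<Sum>x\<in>X. (\<Sum>k\<in>A. c k * u k x) * adjacency E x y)
      = (\<Sum>k\<in>A. c k * (\<Sum>x\<in>X. u k x * adjacency E x y))"
    by (simp add: sum_distrib_left sum_distrib_right mult.assoc) (rule sum.swap)
  also have "\<dots> = lam * (\<Sum>k\<in>A. c k * u k y)"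
    using assms y by (simp add: eigenfunction_def sum_distrib_left mult_ac)
  finally show "(\<Sum>x\<in>X. (\<Sum>k\<in>A. c k * u k x) * adjacency E x y) = lam * (\<Sum>k\<in>A. c k * u k y)" .
qed

text \<open>An automorphism of the digraph commutes with the adjacency operator: reindex the sum
  over \<open>X\<close> by \<open>g\<close>.\<close>

lemma eigenfunction_comp:
  assumes w: "eigenfunction X E lam w" and g: "bij_betw g X X"
    and inv: "\<And>x y. x \<in> X \<Longrightarrow> y \<in> X \<Longrightarrow> (g x, g y) \<in> E \<longleftrightarrow> (x, y) \<in> E"
  shows "eigenfunction X E lam (\<lambda>x. w (g x))"
  unfolding eigenfunction_def
proof
  fix y assume y: "y \<in> X"
  have "(\<Sum>x\<in>X. w (g x) * adjacency E x y) = (\<Sum>x\<in>X. w (g x) * adjacency E (g x) (g y))"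
    using inv y by (simp add: adjacency_def)
  also have "\<dots> = (\<Sum>x\<in>X. w x * adjacency E x (g y))"
    by (rule sum.reindex_bij_betw[OF g])
  also have "\<dots> = lam * w (g y)"
    using w bij_betwE[OF g] y by (simp add: eigenfunction_def)
  finally show "(\<Sum>x\<in>X. w (g x) * adjacency E x y) = lam * w (g y)" .
qed

section \<open>Permutation groups\<close>

lemma perm_grp_action:
  assumes "subgroup A (BijGroup X)"
  shows "group_action (perm_grp X A) X (\<lambda>g. g)"
proof -
  have "group (perm_grp X A)"
    using subgroup.subgroup_is_group[OF assms group_BijGroup] .
  then show ?thesis
    using subgroup.subset[OF assms] group_BijGroup
    by (auto simp: group_action_def group_hom_def group_hom_axioms_def hom_def)
qed

lemma finite_BijGroup:
  assumes "finite X"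
  shows "finite (carrier (BijGroup X))"
proof (rule finite_subset)
  show "carrier (BijGroup X) \<subseteq> X \<rightarrow>\<^sub>E X"
    by (auto simp: BijGroup_def Bij_def PiE_def bij_betw_def)
qed (use assms in \<open>simp add: finite_PiE\<close>)

lemma perm_grp_inv:
  assumes "subgroup A (BijGroup X)" "g \<in> A"
  shows "inv\<^bsub>perm_grp X A\<^esub> g = inv\<^bsub>BijGroup X\<^esub> g"
  using group.m_inv_consistent[OF group_BijGroup assms] .

locale perm_group =
  fixes X :: "'a set" and A :: "('a \<Rightarrow> 'a) set"
  assumes subgroup: "subgroup A (BijGroup X)"
begin

sublocale act: group_action "perm_grp X A" X "\<lambda>g. g"
  by (rule perm_grp_action[OF subgroup])

sublocale grp: group "perm_grp X A"
  by (rule subgroup.subgroup_is_group[OF subgroup group_BijGroup])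

lemma closed: "g \<in> A \<Longrightarrow> x \<in> X \<Longrightarrow> g x \<in> X"
  using act.element_image by auto

lemma bij: "g \<in> A \<Longrightarrow> bij_betw g X X"
  using act.bij_prop0 by (simp add: Bij_def)

lemma mult_apply: "g \<in> A \<Longrightarrow> h \<in> A \<Longrightarrow> x \<in> X \<Longrightarrow> (g \<otimes>\<^bsub>BijGroup X\<^esub> h) x = g (h x)"
  using act.composition_rule by simp

lemma one_apply: "x \<in> X \<Longrightarrow> \<one>\<^bsub>BijGroup X\<^esub> x = x"
  by (simp add: BijGroup_def)

lemma inv_closed: "g \<in> A \<Longrightarrow> inv\<^bsub>BijGroup X\<^esub> g \<in> A"
  using subgroup.m_inv_closed[OF subgroup] .

lemma inv_apply: "g \<in> A \<Longrightarrow> x \<in> X \<Longrightarrow> (inv\<^bsub>BijGroup X\<^esub> g) (g x) = x"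
  using act.orbit_sym_aux[of g x] by (simp add: perm_grp_inv[OF subgroup])

lemma apply_inv: "g \<in> A \<Longrightarrow> x \<in> X \<Longrightarrow> g ((inv\<^bsub>BijGroup X\<^esub> g) x) = x"
  using inv_apply[of "inv\<^bsub>BijGroup X\<^esub> g" x] inv_closed[of g]
    group.inv_inv[OF group_BijGroup subgroup.mem_carrier[OF subgroup, of g]] by simp

lemma pow_apply:
  "g \<in> A \<Longrightarrow> x \<in> X \<Longrightarrow> (g [^]\<^bsub>perm_grp X A\<^esub> (k::nat)) x = (g ^^ k) x"
proof (induction k arbitrary: x)
  case (Suc k)
  have "g [^]\<^bsub>perm_grp X A\<^esub> k \<in> A" using grp.nat_pow_closed[of g k] Suc by simp
  then show ?case using Suc closed by (simp add: mult_apply funpow_swap1)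
qed (simp add: one_apply)

text \<open>The group order serves as a common period; this supplies the \<open>n\<close> of
  \<open>cyclic_part\<close>.\<close>

lemma period:
  assumes "finite X" "g \<in> A"
  shows "\<exists>n>0. \<forall>x\<in>X. (g ^^ n) x = x"
proof (intro exI conjI ballI)
  have "finite (carrier (perm_grp X A))"
    using finite_subset[OF subgroup.subset[OF subgroup] finite_BijGroup[OF assms(1)]] by simp
  then show "Coset.order (perm_grp X A) > 0" by (simp add: grp.order_gt_0_iff_finite)
  show "(g ^^ Coset.order (perm_grp X A)) x = x" if "x \<in> X" for x
    using grp.pow_order_eq_1[of g] assms(2) that by (simp flip: pow_apply add: one_apply)
qed

end

section \<open>Symbols and eigenspace kernels\<close>

locale invariant_digraph_action = perm_group X G for X :: "'a set" and G +
  fixes E :: "('a \<times> 'a) set"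
  assumes finite: "finite X"
    and transitive: "transitive_action (perm_grp X G) X (\<lambda>g. g)"
    and invariant: "invariant_digraph X G E"
begin

text \<open>Invariance is given as an equality of images; the backward direction applies it to the
  inverse permutation.\<close>

lemma arc_iff:
  assumes g: "g \<in> G" and xy: "x \<in> X" "y \<in> X"
  shows "(g x, g y) \<in> E \<longleftrightarrow> (x, y) \<in> E"
proof
  have img: "(\<lambda>(x, y). (k x, k y)) ` E = E" if "k \<in> G" for k
    using invariant that by (auto simp: invariant_digraph_def)
  show "(g x, g y) \<in> E" if "(x, y) \<in> E"
    using img[OF g] that by (metis (mono_tags, lifting) case_prod_conv image_eqI)
  show "(x, y) \<in> E" if "(g x, g y) \<in> E"
    using img[OF inv_closed[OF g]] that inv_apply[OF g] xy
    by (metis (mono_tags, lifting) case_prod_conv image_eqI)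
qed

lemma eigenfunction_action:
  "eigenfunction X E lam w \<Longrightarrow> g \<in> G \<Longrightarrow> eigenfunction X E lam (\<lambda>x. w (g x))"
  by (rule eigenfunction_comp) (auto intro: bij simp: arc_iff)

lemma transitiveE:
  assumes "x \<in> X" "y \<in> X"
  obtains g where "g \<in> G" "g x = y"
  using transitive_action.unique_orbit[OF transitive assms] by auto

text \<open>\<open>valency\<close> is a definite description of one number serving as both degrees.
  Transitivity makes each degree constant, and counting all arcs by tail and by head makes the two
  constants equal. The in-degree is the column sum met by row vectors.\<close>

lemma in_degree:
  assumes y: "y \<in> X"
  shows "card {x\<in>X. (x, y) \<in> E} = valency X E"
proof -
  let ?out = "\<lambda>x. card {y\<in>X. (x, y) \<in> E}" and ?in = "\<lambda>y. card {x\<in>X. (x, y) \<in> E}"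
  have deg: "?out z = ?out y \<and> ?in z = ?in y" if z: "z \<in> X" for z
  proof -
    obtain g where g: "g \<in> G" "g y = z" using transitiveE[OF y z] .
    let ?g' = "inv\<^bsub>BijGroup X\<^esub> g"
    have g': "?g' x \<in> X" "g (?g' x) = x" "?g' (g x) = x" "g x \<in> X" if "x \<in> X" for x
      using that g(1) by (auto intro: closed inv_closed apply_inv inv_apply)
    have arc: "(z, g x) \<in> E \<longleftrightarrow> (y, x) \<in> E" "(g x, z) \<in> E \<longleftrightarrow> (x, y) \<in> E"
      "(y, ?g' x) \<in> E \<longleftrightarrow> (z, x) \<in> E" "(?g' x, y) \<in> E \<longleftrightarrow> (x, z) \<in> E" if "x \<in> X" for x
      using arc_iff[OF g(1)] g(2) y that g'[OF that] by metis+
    have "bij_betw g {x\<in>X. (y, x) \<in> E} {x\<in>X. (z, x) \<in> E}"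
      "bij_betw g {x\<in>X. (x, y) \<in> E} {x\<in>X. (x, z) \<in> E}"
      by (intro bij_betw_byWitness[of _ ?g']; auto simp: g' arc)+
    then show ?thesis by (simp add: bij_betw_same_card)
  qed
  define d e where "d = ?out y" and "e = ?in y"
  have d: "?out x = d" and e: "?in x = e" if "x \<in> X" for x
    using deg[OF that] by (auto simp: d_def e_def)
  have "card X * d = (\<Sum>x\<in>X. ?out x)"
    using d by simp
  also have "\<dots> = e * card X"
    using finite e by (intro sum_multicount) auto
  \<comment> \<open>The vertex \<open>y\<close> shows that \<open>X\<close> is nonempty, so
    \<open>card X\<close> cancels.\<close>
  finally have "d = e"
    using finite y by auto
  then have "valency X E = e"
    unfolding valency_def using d e y by (intro the_equality) auto
  then show ?thesis using e y by simp
qed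

text \<open>Removes the inverse and the extensionality from the definition: evaluate the fixed
  vector at \<open>n x\<close> in one direction, and use the invariance at the preimage of
  \<open>x\<close> in the other.\<close>

lemma eigenspace_kernel_iff:
  "n \<in> eigenspace_kernel X G E lam \<longleftrightarrow>
     n \<in> G \<and> (\<forall>w x. eigenfunction X E lam w \<longrightarrow> x \<in> X \<longrightarrow> w (n x) = w x)"
proof (intro iffI conjI allI impI)
  fix w x assume n: "n \<in> eigenspace_kernel X G E lam"
    and w: "eigenfunction X E lam w" and x: "x \<in> X"
  then have nG: "n \<in> G" by (simp add: eigenspace_kernel_def)
  have "restrict w X \<in> eigenspace X E lam"
    using w by (simp add: eigenspace_eq eigenfunction_cong[of X "restrict w X" w])
  then have "vector_action X n (restrict w X) = restrict w X"
    using n by (simp add: eigenspace_kernel_def)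
  then have "vector_action X n (restrict w X) (n x) = restrict w X (n x)" by simp
  then show "w (n x) = w x"
    using nG x by (simp add: vector_action_def closed inv_apply)
next
  assume n: "n \<in> G \<and> (\<forall>w x. eigenfunction X E lam w \<longrightarrow> x \<in> X \<longrightarrow> w (n x) = w x)"
  have "vector_action X n w = w" if w: "w \<in> eigenspace X E lam" for w
  proof (rule extensionalityI[of _ X])
    fix x assume x: "x \<in> X"
    then have "(inv\<^bsub>BijGroup X\<^esub> n) x \<in> X" using n closed inv_closed by blast
    then show "vector_action X n w x = w x"
      using n w x apply_inv[of n x] by (simp add: vector_action_def eigenspace_eq) metis
  qed (use w in \<open>auto simp: vector_action_def eigenspace_eq\<close>)
  then show "n \<in> eigenspace_kernel X G E lam"
    using n by (simp add: eigenspace_kernel_def)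
qed (simp add: eigenspace_kernel_def)

section \<open>The kernel as a normal subgroup, and its orbits\<close>

lemma subgroup_eigenspace_kernel: "subgroup (eigenspace_kernel X G E lam) (BijGroup X)"
proof (rule group.subgroupI[OF group_BijGroup])
  show "eigenspace_kernel X G E lam \<subseteq> carrier (BijGroup X)"
    using subgroup.subset[OF subgroup] by (auto simp: eigenspace_kernel_def)
  have "\<one>\<^bsub>BijGroup X\<^esub> \<in> eigenspace_kernel X G E lam"
    using subgroup.one_closed[OF subgroup] by (simp add: eigenspace_kernel_iff one_apply)
  then show "eigenspace_kernel X G E lam \<noteq> {}" by auto
next
  fix a assume a: "a \<in> eigenspace_kernel X G E lam"
  then have aG: "a \<in> G" by (simp add: eigenspace_kernel_def)
  have "w ((inv\<^bsub>BijGroup X\<^esub> a) x) = w x" if "eigenfunction X E lam w" "x \<in> X" for w x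
    using a that apply_inv[OF aG that(2)] closed[OF inv_closed[OF aG] that(2)]
    by (metis eigenspace_kernel_iff)
  then show "inv\<^bsub>BijGroup X\<^esub> a \<in> eigenspace_kernel X G E lam"
    using inv_closed[OF aG] by (simp add: eigenspace_kernel_iff)
next
  fix a b assume ab: "a \<in> eigenspace_kernel X G E lam" "b \<in> eigenspace_kernel X G E lam"
  then have G: "a \<in> G" "b \<in> G" by (simp_all add: eigenspace_kernel_def)
  have "w (a (b x)) = w x" if "eigenfunction X E lam w" "x \<in> X" for w x
    using ab that closed[OF G(2) that(2)] by (metis eigenspace_kernel_iff)
  then show "a \<otimes>\<^bsub>BijGroup X\<^esub> b \<in> eigenspace_kernel X G E lam"
    using G subgroup.m_closed[OF subgroup] by (simp add: eigenspace_kernel_iff mult_apply)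
qed

text \<open>If \<open>w\<close> is an eigenfunction, so is its composition with \<open>g\<close>;
  \<open>n\<close> fixes the latter, hence the conjugate fixes \<open>w\<close>.\<close>

lemma eigenspace_kernel_conj:
  assumes g: "g \<in> G" and n: "n \<in> eigenspace_kernel X G E lam"
  shows "g \<otimes>\<^bsub>BijGroup X\<^esub> n \<otimes>\<^bsub>BijGroup X\<^esub> inv\<^bsub>BijGroup X\<^esub> g \<in> eigenspace_kernel X G E lam"
proof -
  have nG: "n \<in> G" using n by (simp add: eigenspace_kernel_def)
  have gn: "g \<otimes>\<^bsub>BijGroup X\<^esub> n \<in> G" using g nG subgroup.m_closed[OF subgroup] by blast
  have "w (g (n ((inv\<^bsub>BijGroup X\<^esub> g) x))) = w x" if "eigenfunction X E lam w" "x \<in> X" for w x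
    using n eigenfunction_action[OF that(1) g] closed[OF inv_closed[OF g] that(2)]
      apply_inv[OF g that(2)] unfolding eigenspace_kernel_iff by metis
  then show ?thesis
    using g nG gn inv_closed[OF g] subgroup.m_closed[OF subgroup]
    by (simp add: eigenspace_kernel_iff mult_apply closed)
qed

text \<open>Orbits of a normal subgroup are permuted by the whole group.\<close>

lemma block_system_eigenspace_kernel:
  "block_system X G (perm_orbits X (eigenspace_kernel X G E lam))"
proof -
  define N where "N = eigenspace_kernel X G E lam"
  interpret N: perm_group X N
    by (rule perm_group.intro) (simp add: N_def subgroup_eigenspace_kernel)
  let ?orb = "orbit (perm_grp X N) (\<lambda>g. g)"
  have "partition_on X (perm_orbits X N)"
    unfolding perm_orbits_def
  proof (rule partition_onI)
    show "\<Union> (orbits (perm_grp X N) X (\<lambda>g. g)) = X" by (rule N.act.orbits_coverture)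
    show "{} \<notin> orbits (perm_grp X N) X (\<lambda>g. g)"
      using N.act.orbit_refl by (auto simp: orbits_def)
  qed (use N.act.disjoint_union in \<open>auto simp: disjnt_def\<close>)
  moreover have "(\<lambda>B. g ` B) ` perm_orbits X N = perm_orbits X N" if g: "g \<in> G" for g
  proof -
    have sub: "k ` ?orb x \<subseteq> ?orb (k x)" if k: "k \<in> G" and x: "x \<in> X" for k x
    proof
      fix z assume "z \<in> k ` ?orb x"
      then obtain n where n: "n \<in> N" "z = k (n x)" by (auto simp: orbit_def)
      then have nG: "n \<in> G" by (simp add: N_def eigenspace_kernel_def)
      \<comment> \<open>The conjugate of \<open>n\<close> by \<open>k\<close> carries
        \<open>k x\<close> to \<open>k (n x)\<close>, which is \<open>z\<close>.\<close>
      let ?n = "k \<otimes>\<^bsub>BijGroup X\<^esub> n \<otimes>\<^bsub>BijGroup X\<^esub> inv\<^bsub>BijGroup X\<^esub> k"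
      have "?n \<in> N" using eigenspace_kernel_conj k n by (simp add: N_def)
      moreover have "?n (k x) = z"
        using n nG k x inv_closed[OF k] subgroup.m_closed[OF subgroup]
        by (simp add: mult_apply closed inv_apply)
      ultimately show "z \<in> ?orb (k x)" by (force simp: orbit_def)
    qed
    have orb: "g ` ?orb x = ?orb (g x)" if x: "x \<in> X" for x
    proof
      show "?orb (g x) \<subseteq> g ` ?orb x"
      proof
        fix z assume z: "z \<in> ?orb (g x)"
        then have zX: "z \<in> X" using closed[OF g x] N.closed by (auto simp: orbit_def)
        \<comment> \<open>The reverse inclusion is \<open>sub\<close> for the inverse of
          \<open>g\<close>, started at \<open>g x\<close>.\<close>
        have "(inv\<^bsub>BijGroup X\<^esub> g) z \<in> ?orb x"
          using sub[OF inv_closed[OF g] closed[OF g x]] z inv_apply[OF g x] by auto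
        then show "z \<in> g ` ?orb x" using apply_inv[OF g zX] by force
      qed
    qed (rule sub[OF g x])
    have "(\<lambda>B. g ` B) ` perm_orbits X N = ?orb ` g ` X"
      using orb by (auto simp: perm_orbits_def orbits_def image_iff)
    also have "g ` X = X" using bij[OF g] by (simp add: bij_betw_def)
    finally show ?thesis by (auto simp: perm_orbits_def orbits_def)
  qed
  ultimately show ?thesis by (simp add: block_system_def N_def)
qed

text \<open>A transitive kernel makes a nonzero eigenfunction constant, and its equation at
  \<open>y\<close> then reads off the in-degree as the eigenvalue.\<close>

lemma perm_orbits_eigenspace_kernel_neq:
  assumes ev: "is_eigenvalue X E lam" and lam: "lam \<noteq> of_nat (valency X E)"
  shows "perm_orbits X (eigenspace_kernel X G E lam) \<noteq> {X}"
proof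
  assume orb: "perm_orbits X (eigenspace_kernel X G E lam) = {X}"
  obtain w where w: "w \<in> extensional X" "eigenfunction X E lam w" "w \<noteq> (\<lambda>x\<in>X. 0)"
    using ev by (auto simp: is_eigenvalue_def eigenspace_eq)
  then obtain y where y: "y \<in> X" "w y \<noteq> 0"
    by (metis extensionalityI restrict_apply restrict_extensional)
  have const: "w x = w y" if x: "x \<in> X" for x
  proof -
    have "orbit (perm_grp X (eigenspace_kernel X G E lam)) (\<lambda>g. g) y = X"
      using orb y by (auto simp: perm_orbits_def orbits_def)
    then have "x \<in> orbit (perm_grp X (eigenspace_kernel X G E lam)) (\<lambda>g. g) y" using x by simp
    then obtain n where "n \<in> eigenspace_kernel X G E lam" "n y = x"
      by (auto simp: orbit_def)
    then show ?thesis using w y by (auto simp: eigenspace_kernel_iff)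
  qed
  have "lam * w y = (\<Sum>x\<in>X. w x * adjacency E x y)"
    using w y by (simp add: eigenfunction_def)
  also have "\<dots> = (\<Sum>x\<in>X. if (x, y) \<in> E then w y else 0)"
    using const by (intro sum.cong) (auto simp: adjacency_def)
  also have "\<dots> = of_nat (card {x\<in>X. (x, y) \<in> E}) * w y"
    using finite by (simp add: sum.If_cases Int_def)
  finally show False using lam y in_degree by simp
qed

end

section \<open>Coordinates relative to the semiregular subgroup, and the character matrix\<close>

locale abelian_semiregular_symbol = invariant_digraph_action X G E
  for X :: "'a set" and G E +
  fixes H :: "('a \<Rightarrow> 'a) set" and m :: nat and Xs :: "nat \<Rightarrow> 'a set" and b :: "nat \<Rightarrow> 'a"
  assumes H_subgroup: "subgroup H (perm_grp X G)"
    and H_comm: "comm_group (perm_grp X H)"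
    and H_semiregular: "semiregular X H"
    and points: "reference_points X H m Xs b"
begin

sublocale H: perm_group X H
  by (rule perm_group.intro) (rule group.incl_subgroup[OF group_BijGroup subgroup H_subgroup])

lemma H_sub: "H \<subseteq> G"
  using subgroup.subset[OF H_subgroup] by simp

lemma finite_H: "Finite_Set.finite H"
  using finite_subset[OF subgroup.subset[OF H.subgroup] finite_BijGroup[OF finite]] .

text \<open>The orbit of a point determines \<open>i\<close>, and trivial stabilizers make
  \<open>h\<close> unique. This identifies \<open>X\<close> with \<open>m\<close> copies of
  \<open>H\<close>, so that sums over \<open>X\<close> become double sums.\<close>

lemma bij_betw_points: "bij_betw (\<lambda>(i, h). h (b i)) ({..<m} \<times> H) X"
proof -
  let ?orb = "orbit (perm_grp X H) (\<lambda>g. g)"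
  have Xs: "bij_betw Xs {..<m} (orbits (perm_grp X H) X (\<lambda>g. g))" and b: "\<And>i. i < m \<Longrightarrow> b i \<in> Xs i"
    using points by (auto simp: reference_points_def perm_orbits_def)
  have Xs_orb: "Xs i \<in> orbits (perm_grp X H) X (\<lambda>g. g)" if "i < m" for i
    using bij_betwE[OF Xs] that by blast
  have bX: "b i \<in> X" if "i < m" for i
    using b[OF that] Xs_orb[OF that] H.act.orbits_coverture by blast
  have Xs_eq: "Xs i = ?orb (b i)" if i: "i < m" for i
  proof -
    have "?orb (b i) \<in> orbits (perm_grp X H) X (\<lambda>g. g)" using bX[OF i] by (auto simp: orbits_def)
    moreover have "b i \<in> ?orb (b i)" using H.act.orbit_refl[OF bX[OF i]] .
    ultimately show ?thesis using H.act.disjoint_union[OF Xs_orb[OF i]] b[OF i] by blast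
  qed
  have "inj_on (\<lambda>(i, h). h (b i)) ({..<m} \<times> H)"
  proof (rule inj_onI, clarify)
    fix i j g h assume ij: "i < m" "j < m" and gh: "g \<in> H" "h \<in> H" and eq: "g (b i) = h (b j)"
    have "g (b i) \<in> Xs i" "h (b j) \<in> Xs j" using ij gh by (auto simp: Xs_eq orbit_def)
    then have "Xs i = Xs j" using H.act.disjoint_union[OF Xs_orb Xs_orb] ij eq by force
    then have ij_eq: "i = j" using bij_betw_imp_inj_on[OF Xs] ij by (auto dest: inj_onD)
    \<comment> \<open>Once \<open>i = j\<close>, this element fixes \<open>b i\<close>, so
      semiregularity makes it the identity.\<close>
    let ?k = "inv\<^bsub>BijGroup X\<^esub> h \<otimes>\<^bsub>BijGroup X\<^esub> g"
    have kH: "?k \<in> H" using gh H.inv_closed subgroup.m_closed[OF H.subgroup] by blast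
    have "?k (b i) = b i"
      using gh H.inv_closed bX[OF ij(1)] eq ij_eq by (simp add: H.mult_apply H.inv_apply)
    then have "?k \<in> stabilizer (perm_grp X H) (\<lambda>g. g) (b i)" using kH by (simp add: stabilizer_def)
    then have "?k = \<one>\<^bsub>BijGroup X\<^esub>"
      using H_semiregular bX[OF ij(1)] by (auto simp: semiregular_def)
    then have "inv\<^bsub>BijGroup X\<^esub> g = inv\<^bsub>BijGroup X\<^esub> h"
      using gh subgroup.mem_carrier[OF H.subgroup]
      by (intro group.inv_equality[OF group_BijGroup]) (auto intro: group.inv_closed[OF group_BijGroup])
    then show "i = j \<and> g = h"
      using ij_eq gh subgroup.mem_carrier[OF H.subgroup] group.inv_inv[OF group_BijGroup] by metis
  qed
  moreover have "(\<lambda>(i, h). h (b i)) ` ({..<m} \<times> H) = X"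
  proof
    show "(\<lambda>(i, h). h (b i)) ` ({..<m} \<times> H) \<subseteq> X" using H.closed bX by auto
    show "X \<subseteq> (\<lambda>(i, h). h (b i)) ` ({..<m} \<times> H)"
    proof
      fix x assume "x \<in> X"
      then have "x \<in> \<Union> (Xs ` {..<m})"
        using H.act.orbits_coverture bij_betw_imp_surj_on[OF Xs] by simp
      then obtain i where "i < m" "x \<in> ?orb (b i)" using Xs_eq by auto
      then show "x \<in> (\<lambda>(i, h). h (b i)) ` ({..<m} \<times> H)" by (auto simp: orbit_def)
    qed
  qed
  ultimately show ?thesis by (simp add: bij_betw_def)
qed

lemma point_in_X: "i < m \<Longrightarrow> b i \<in> X"
  using points H.act.orbits_coverture bij_betwE[of Xs "{..<m}" "perm_orbits X H"]
  unfolding reference_points_def perm_orbits_def by blast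

abbreviation "S \<equiv> digraph_symbol H E b"

abbreviation "K lam \<equiv> K_set (perm_grp X H) m S lam"

text \<open>Write the eigenvalue equation at \<open>b j\<close> in the coordinates
  \<open>(i, h)\<close>. Since \<open>v (h (b i)) = \<chi> h * v (b i)\<close>, the sum over
  \<open>h\<close> collapses to the entry \<open>(i, j)\<close> of the character matrix times
  \<open>v (b i)\<close>.\<close>

lemma joint_eigenfunction_character:
  assumes v: "eigenfunction X E lam v" and \<chi>: "linear_character (perm_grp X H) \<chi>"
    and eq: "\<And>h x. h \<in> H \<Longrightarrow> x \<in> X \<Longrightarrow> v (h x) = \<chi> h * v x"
    and ne: "x0 \<in> X" "v x0 \<noteq> 0"
  shows "\<chi> \<in> K lam"
proof -
  interpret comm_group "perm_grp X H" by (rule H_comm)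
  define M where "M = character_matrix (perm_grp X H) m S \<chi> - lam \<cdot>\<^sub>m 1\<^sub>m m"
  define u where "u = vec m (\<lambda>i. v (b i))"
  have M: "M \<in> carrier_mat m m" by (simp add: M_def minus_carrier_mat)
  have col: "(\<Sum>i<m. character_sum (perm_grp X H) \<chi> (S i j) * v (b i)) = lam * v (b j)"
    if j: "j < m" for j
  proof -
    have "character_sum (perm_grp X H) \<chi> (S i j) * v (b i)
        = (\<Sum>h\<in>H. v (h (b i)) * adjacency E (h (b i)) (b j))" if i: "i < m" for i
    proof -
      \<comment> \<open>Substituting the inverse of \<open>h\<close> for \<open>g\<close> absorbs
        the inverse in \<open>character_sum\<close>, and applying \<open>h\<close> turns an arc from
        \<open>b i\<close> to the translate of \<open>b j\<close> into one from
        \<open>h (b i)\<close> to \<open>b j\<close>.\<close>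
      have inv_bij: "bij_betw (\<lambda>h. inv\<^bsub>BijGroup X\<^esub> h) H H"
        using H.inv_closed subgroup.mem_carrier[OF H.subgroup] group.inv_inv[OF group_BijGroup]
        by (intro bij_betw_byWitness[of _ "\<lambda>h. inv\<^bsub>BijGroup X\<^esub> h"]) auto
      have "character_sum (perm_grp X H) \<chi> (S i j) * v (b i)
          = (\<Sum>g\<in>{g\<in>H. (b i, g (b j)) \<in> E}. \<chi> (inv\<^bsub>BijGroup X\<^esub> g) * v (b i))"
        unfolding character_sum_def digraph_symbol_def sum_distrib_right
        by (intro sum.cong) (simp_all add: perm_grp_inv[OF H.subgroup])
      also have "\<dots> = (\<Sum>g\<in>H. \<chi> (inv\<^bsub>BijGroup X\<^esub> g) * v (b i) * adjacency E (b i) (g (b j)))"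
        using finite_H by (auto simp: adjacency_def sum.If_cases Int_def if_distrib cong: if_cong)
      also have "\<dots> = (\<Sum>h\<in>H. \<chi> h * v (b i) * adjacency E (b i) ((inv\<^bsub>BijGroup X\<^esub> h) (b j)))"
        using subgroup.mem_carrier[OF H.subgroup]
        by (subst sum.reindex_bij_betw[OF inv_bij, symmetric])
          (simp add: group.inv_inv[OF group_BijGroup])
      also have "\<dots> = (\<Sum>h\<in>H. v (h (b i)) * adjacency E (h (b i)) (b j))"
      proof (intro sum.cong refl)
        fix h assume h: "h \<in> H"
        let ?y = "(inv\<^bsub>BijGroup X\<^esub> h) (b j)"
        have "(h (b i), h ?y) \<in> E \<longleftrightarrow> (b i, ?y) \<in> E"
          using h H_sub i j by (intro arc_iff) (auto simp: point_in_X H.closed H.inv_closed)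
        then have "adjacency E (b i) ?y = adjacency E (h (b i)) (b j)"
          using h j by (simp add: adjacency_def H.apply_inv point_in_X)
        then show "\<chi> h * v (b i) * adjacency E (b i) ?y = v (h (b i)) * adjacency E (h (b i)) (b j)"
          using h i by (simp add: eq point_in_X)
      qed
      finally show ?thesis .
    qed
    then have "(\<Sum>i<m. character_sum (perm_grp X H) \<chi> (S i j) * v (b i))
        = (\<Sum>i<m. \<Sum>h\<in>H. v (h (b i)) * adjacency E (h (b i)) (b j))"
      by simp
    also have "\<dots> = (\<Sum>(i, h)\<in>{..<m} \<times> H. v (h (b i)) * adjacency E (h (b i)) (b j))"
      by (rule sum.cartesian_product)
    also have "\<dots> = (\<Sum>x\<in>X. v x * adjacency E x (b j))"
      by (subst sum.reindex_bij_betw[OF bij_betw_points, symmetric]) (simp add: case_prod_unfold)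
    also have "\<dots> = lam * v (b j)"
      using v point_in_X[OF j] by (simp add: eigenfunction_def)
    finally show ?thesis .
  qed
  \<comment> \<open>The row vector \<open>u\<close> is killed by \<open>M\<close> from the right;
    transposing gives the column form used by the determinant criterion.\<close>
  have "M\<^sup>T *\<^sub>v u = 0\<^sub>v m"
  proof (rule eq_vecI)
    fix j assume "j < dim_vec (0\<^sub>v m :: complex vec)"
    then have j: "j < m" by simp
    have "(M\<^sup>T *\<^sub>v u) $ j = (\<Sum>i<m. M $$ (i, j) * v (b i))"
      using M j by (simp add: scalar_prod_def u_def lessThan_atLeast0)
    also have "\<dots> = (\<Sum>i<m. character_sum (perm_grp X H) \<chi> (S i j) * v (b i)
                          - (if i = j then lam * v (b i) else 0))"
      using j by (intro sum.cong) (auto simp: M_def character_matrix_def algebra_simps)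
    also have "\<dots> = 0" using col[OF j] j by (simp add: sum_subtractf)
    finally show "(M\<^sup>T *\<^sub>v u) $ j = 0\<^sub>v m $ j" using j by simp
  qed (use M in simp)
  \<comment> \<open>The point \<open>x0\<close> lies in the orbit of some \<open>b i\<close>, and
    \<open>v x0\<close> is a multiple of \<open>v (b i)\<close>.\<close>
  moreover have "u \<noteq> 0\<^sub>v m"
  proof -
    obtain i h where ih: "i < m" "h \<in> H" "x0 = h (b i)"
      using bij_betw_imp_surj_on[OF bij_betw_points] ne(1) by (auto simp: image_iff)
    then have "v (b i) \<noteq> 0" using ne(2) eq point_in_X by auto
    then show ?thesis using ih by (auto simp: u_def dest: arg_cong[of _ _ "\<lambda>v. v $ i"])
  qed
  moreover have "u \<in> carrier_vec m" by (simp add: u_def)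
  ultimately have "det M\<^sup>T = 0"
    using det_0_iff_vec_prod_zero_field[of "M\<^sup>T" m] M by auto
  then have "det M = 0" using det_transpose[OF M] by simp
  then show ?thesis
    using \<chi> by (simp add: K_set_def character_group_def irreducible_characters_eq M_def)
qed

text \<open>Splitting into joint eigenfunctions of \<open>H\<close> reduces the claim to a single
  \<open>v\<close>, on which \<open>h\<close> acts by the value at \<open>h\<close> of a character
  in \<open>K lam\<close>.\<close>

lemma perp_subset_kernel:
  "character_perp (perm_grp X H) (generate (character_group (perm_grp X H)) (K lam))
     \<subseteq> eigenspace_kernel X G E lam"
proof
  interpret comm_group "perm_grp X H" by (rule H_comm)
  fix h assume h: "h \<in> character_perp (perm_grp X H) (generate (character_group (perm_grp X H)) (K lam))"
  then have hH: "h \<in> H" by (simp add: character_perp_def)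
  have K: "\<chi> h = \<chi> \<one>\<^bsub>BijGroup X\<^esub>" if "\<chi> \<in> K lam" for \<chi>
    using h generate.incl[OF that] by (auto simp: character_perp_def character_kernel_def)
  have "w (h x) = w x" if w: "eigenfunction X E lam w" and x: "x \<in> X" for w x
  proof (rule invariant_if_joint_eigenfunctions_invariant
      [where F = H and W = "{w. eigenfunction X E lam w}" and X = X])
    show "f (g x) = g (f x)" if "f \<in> H" "g \<in> H" "x \<in> X" for f g x
      using that m_comm[of f g] by (simp flip: H.mult_apply)
    show "v (h x) = v x"
      if v: "v \<in> {w. eigenfunction X E lam w}" "\<forall>f\<in>H. \<exists>c. \<forall>x\<in>X. v (f x) = c * v x" and x: "x \<in> X"
      for v x
    proof (cases "\<forall>x\<in>X. v x = 0")
      case True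
      then show ?thesis using x H.closed[OF hH] by simp
    next
      case False
      then obtain y where y: "y \<in> X" "v y \<noteq> 0" by auto
      \<comment> \<open>The eigenvalue of \<open>v\<close> under \<open>f\<close>, read off at a
        point where \<open>v\<close> does not vanish.\<close>
      define \<chi> where "\<chi> = (\<lambda>f\<in>H. v (f y) / v y)"
      have eq: "v (f x) = \<chi> f * v x" if f: "f \<in> H" and x: "x \<in> X" for f x
      proof -
        obtain c where "\<forall>x\<in>X. v (f x) = c * v x" using v f by blast
        then show ?thesis using y f x by (simp add: \<chi>_def)
      qed
      have "\<chi> (f \<otimes>\<^bsub>BijGroup X\<^esub> g) = \<chi> f * \<chi> g" if "f \<in> H" "g \<in> H" for f g
        using that y eq[of f "g y"] subgroup.m_closed[OF H.subgroup that]
        by (simp add: \<chi>_def[unfolded restrict_def] H.mult_apply H.closed)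
      then have \<chi>: "linear_character (perm_grp X H) \<chi>"
        using y subgroup.one_closed[OF H.subgroup]
        by (auto simp: linear_character_def \<chi>_def H.one_apply)
      then have "\<chi> h = 1"
        using K[OF joint_eigenfunction_character[OF _ \<chi> eq y]] v by (simp add: linear_character_def)
      then show ?thesis using eq[OF hH x] by simp
    qed
  qed (use w x hH finite_H H_sub in \<open>auto intro: H.closed H.period[OF finite]
      eigenfunction_action eigenfunction_sum\<close>)
  then show "h \<in> eigenspace_kernel X G E lam"
    using hH H_sub by (auto simp: eigenspace_kernel_iff)
qed

text \<open>A proper subgroup of characters has a nontrivial annihilator. It lies in the kernel, so
  singleton orbits would force its elements to fix every point.\<close>

lemma perm_orbits_neq_singletons:
  assumes "generate (character_group (perm_grp X H)) (K lam) \<subset> carrier (character_group (perm_grp X H))"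
  shows "perm_orbits X (eigenspace_kernel X G E lam) \<noteq> (\<lambda>x. {x}) ` X"
proof
  assume orb: "perm_orbits X (eigenspace_kernel X G E lam) = (\<lambda>x. {x}) ` X"
  interpret comm_group "perm_grp X H" by (rule H_comm)
  let ?L = "generate (character_group (perm_grp X H)) (K lam)"
  have "character_perp (perm_grp X H) ?L \<noteq> {\<one>\<^bsub>perm_grp X H\<^esub>}"
  proof (rule character_perp_nontrivial)
    show "?L \<subset> {\<chi>. linear_character (perm_grp X H) \<chi>}"
      using assms by (simp add: character_group_def irreducible_characters_eq)
    show "?L \<noteq> {}" using generate.one by fast
    show "(\<lambda>h\<in>carrier (perm_grp X H). \<chi> h * \<psi> h) \<in> ?L" if "\<chi> \<in> ?L" "\<psi> \<in> ?L" for \<chi> \<psi>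
      using generate.eng[OF that] by (simp add: character_group_def)
  qed (simp add: finite_H)
  \<comment> \<open>Knowing that the identity belongs to the annihilator turns inequality with the
    singleton into a further element \<open>h\<close>.\<close>
  moreover have "\<one>\<^bsub>BijGroup X\<^esub> \<in> character_perp (perm_grp X H) ?L"
    using subgroup.one_closed[OF H.subgroup] by (simp add: character_perp_def character_kernel_def)
  ultimately obtain h where h: "h \<in> character_perp (perm_grp X H) ?L" "h \<noteq> \<one>\<^bsub>BijGroup X\<^esub>"
    by auto
  then have hH: "h \<in> H" by (simp add: character_perp_def)
  have hN: "h \<in> eigenspace_kernel X G E lam" using perp_subset_kernel h by blast
  have "h x = x" if x: "x \<in> X" for x
  proof -
    interpret N: perm_group X "eigenspace_kernel X G E lam"
      by (rule perm_group.intro) (rule subgroup_eigenspace_kernel)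
    let ?O = "orbit (perm_grp X (eigenspace_kernel X G E lam)) (\<lambda>g. g) x"
    have "?O \<in> (\<lambda>x. {x}) ` X" using orb x by (auto simp: perm_orbits_def orbits_def)
    moreover have "x \<in> ?O" "h x \<in> ?O"
      using N.act.orbit_refl[OF x] hN by (auto simp: orbit_def)
    ultimately show ?thesis by auto
  qed
  \<comment> \<open>Elements of \<open>BijGroup X\<close> are extensional, so fixing all of
    \<open>X\<close> already gives the identity.\<close>
  then have "h = \<one>\<^bsub>BijGroup X\<^esub>"
    using subgroup.mem_carrier[OF H.subgroup hH]
    by (intro extensionalityI[of _ X]) (auto simp: BijGroup_def Bij_def)
  then show False using h by simp
qed

end

theorem theorem5p1:
  fixes X :: "'a set"
    and G H :: "('a \<Rightarrow> 'a) set"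
    and E :: "('a \<times> 'a) set"
    and m :: nat
    and Xs :: "nat \<Rightarrow> 'a set"
    and b :: "nat \<Rightarrow> 'a"
    and S :: "nat \<Rightarrow> nat \<Rightarrow> ('a \<Rightarrow> 'a) set"
    and lam :: complex
  assumes "finite X"
    and "subgroup G (BijGroup X)"
    and "transitive_action (perm_grp X G) X (\<lambda>g. g)"
    and "subgroup H (perm_grp X G)"
    and "comm_group (perm_grp X H)"
    and "semiregular X H"
    and "invariant_digraph X G E"
    and "reference_points X H m Xs b"
    and "S = digraph_symbol H E b"
    and "is_eigenvalue X E lam"
    and "lam \<noteq> of_nat (valency X E)"
  shows "character_perp (perm_grp X H)
           (generate (character_group (perm_grp X H)) (K_set (perm_grp X H) m S lam))
         \<subseteq> eigenspace_kernel X G E lam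
       \<and>
       (generate (character_group (perm_grp X H)) (K_set (perm_grp X H) m S lam)
           \<subset> carrier (character_group (perm_grp X H)) \<longrightarrow>
         nontrivial_block_system X G (perm_orbits X (eigenspace_kernel X G E lam)))"
proof -
  interpret abelian_semiregular_symbol X G E H m Xs b
    using assms
    by (intro abelian_semiregular_symbol.intro invariant_digraph_action.intro perm_group.intro
        invariant_digraph_action_axioms.intro abelian_semiregular_symbol_axioms.intro)
  show ?thesis
    unfolding \<open>S = digraph_symbol H E b\<close> nontrivial_block_system_def
    by (intro conjI impI perp_subset_kernel block_system_eigenspace_kernel
        perm_orbits_neq_singletons perm_orbits_eigenspace_kernel_neq assms)
qed

end
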